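(* Assume $\mathrm{rank}\,R=q$ and $\mathrm{Ker}\,(D_{\xi_0}\varphi)\cap\mathrm{Ker}\,R=\{0\}$. Then: (i) $\mathcal{U}^\perp=\{\sigma\in\mathbb{R}^m:(D_{\xi_0}\varphi)^T\sigma\in\mathrm{Im}\,R^T\}$; moreover $\mathcal{V}=K^{-1}\mathcal{U}^\perp$, so $\dim\mathcal{U}^\perp=\dim\mathcal{V}$, and $\mathcal{V}=\mathcal{U}^{\perp_K}$, the orthogonal complement of $\mathcal U$ with respect to the inner product $(x,y)\mapsto x^TKy$; (ii) for every $\sigma\in\mathbb{R}^m$ and every $f\in\mathbb{R}^{nd}$, $(D_{\xi_0}\varphi)^T(-\sigma+Hf)\in\mathrm{Im}\,R^T$ if and only if $-\sigma+Hf\in\mathcal{U}^\perp$; (iii) $\dim\mathcal{U}=\dim\mathrm{Ker}\,R=nd-q$ and $\dim\mathcal{V}=m-nd+q$.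
   Context: $n,m,d,q$ are positive integers. $Q$ is an $n\times m$ matrix with entries in $\{0,1,-1\}$, each column having exactly one $1$ and one $-1$, other entries $0$. $\xi_0\in\mathbb{R}^{nd}$ lists node coordinates ($\xi^0_{d(j-1)+k}$ is the $k$-th coordinate of node $j$), with the endpoints of each spring distinct. $\varphi:\mathbb{R}^{nd}\to\mathbb{R}^m$, $\varphi_i(\xi)=\sqrt{\sum_{k=1}^d(\sum_{j}Q_{ji}\xi_{d(j-1)+k})^2}$, and $D_{\xi_0}\varphi$ is its $m\times nd$ Jacobian at $\xi_0$: $(D_{\xi_0}\varphi)_{i,d(j-1)+k}=\mathcal{D}_{ik}Q_{ji}$ with $\mathcal{D}_{ik}=\frac{1}{\varphi_i(\xi_0)}\sum_{\bar j}Q_{\bar ji}\xi^0_{d(\bar j-1)+k}$. $R$ is a $q\times nd$ matrix; $K=\mathrm{diag}(k_1,\dots,k_m)$ with all $k_i>0$. $H$ is the $m\times nd$ matrix formed by the first $m$ rows of the Moore–Penrose pseudoinverse of the $nd\times(m+q)$ matrix $\begin{pmatrix}(D_{\xi_0}\varphi)^T & R^T\end{pmatrix}$. $\mathcal{U}=\{(D_{\xi_0}\varphi)\zeta:\zeta\in\mathbb{R}^{nd},\,R\zeta=0\}\subset\mathbb{R}^m$, $\mathcal{V}=\{K^{-1}\sigma:(D_{\xi_0}\varphi)^T\sigma\in\mathrm{Im}\,R^T\}\subset\mathbb{R}^m$, and $\mathcal{U}^\perp$ is the orthogonal complement in the standard inner product. *)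

theory Defs
  imports "HOL-Analysis.Analysis"
begin

text \<open>Index conventions: nodes are a finite type 'n (n = CARD('n)), coordinates a finite
type 'd (d = CARD('d)), springs a finite type 'm, constraints a finite type 'q.
The space R^(nd) is real^('n \<times> 'd); the coordinate (j,k) corresponds to index d(j-1)+k.\<close>

definition incidence_matrix :: "real^'m^'n \<Rightarrow> bool" where
  "incidence_matrix Q \<longleftrightarrow>
     (\<forall>j i. Q$j$i \<in> {0, 1, -1}) \<and>
     (\<forall>i. (\<exists>!j. Q$j$i = 1) \<and> (\<exists>!j. Q$j$i = -1))"

text \<open>Spring lengths phi_i(xi).\<close>
definition spring_len :: "real^'m^'n::finite \<Rightarrow> real^('n \<times> 'd::finite) \<Rightarrow> 'm \<Rightarrow> real" where
  "spring_len Q \<xi> i = sqrt (\<Sum>k\<in>UNIV. (\<Sum>j\<in>UNIV. Q$j$i * \<xi>$(j,k))\<^sup>2)"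

text \<open>The matrix \<D>_{ik}.\<close>
definition calD :: "real^'m^'n::finite \<Rightarrow> real^('n \<times> 'd::finite) \<Rightarrow> 'm \<Rightarrow> 'd \<Rightarrow> real" where
  "calD Q \<xi>0 i k = (1 / spring_len Q \<xi>0 i) * (\<Sum>j\<in>UNIV. Q$j$i * \<xi>0$(j,k))"

text \<open>Jacobian D_{xi0} phi, an m \<times> nd matrix.\<close>
definition Dphi :: "real^'m^'n::finite \<Rightarrow> real^('n \<times> 'd::finite) \<Rightarrow> real^('n \<times> 'd)^'m" where
  "Dphi Q \<xi>0 = (\<chi> i. \<chi> p. calD Q \<xi>0 i (snd p) * Q$(fst p)$i)"

text \<open>Moore--Penrose pseudoinverse: the unique matrix satisfying the four Penrose equations.\<close>
definition is_pinv :: "real^'c^'r \<Rightarrow> real^'r::finite^'c::finite \<Rightarrow> bool" where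
  "is_pinv A X \<longleftrightarrow> A ** X ** A = A \<and> X ** A ** X = X \<and>
     transpose (A ** X) = A ** X \<and> transpose (X ** A) = X ** A"

definition pinv :: "real^'c::finite^'r::finite \<Rightarrow> real^'r^'c" where
  "pinv A = (THE X. is_pinv A X)"

text \<open>The nd \<times> (m+q) block matrix ( D^T  R^T ); columns indexed by 'm + 'q.\<close>
definition block_DR :: "real^'c^'m::finite \<Rightarrow> real^'c^'q::finite \<Rightarrow> real^('m + 'q)^'c" where
  "block_DR D R = (\<chi> r c. case c of Inl i \<Rightarrow> D$i$r | Inr l \<Rightarrow> R$l$r)"

text \<open>H: the first m rows of the pseudoinverse of the block matrix.\<close>
definition Hmat :: "real^'c::finite^'m::finite \<Rightarrow> real^'c^'q::finite \<Rightarrow> real^'c^'m" where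
  "Hmat D R = (\<chi> i. pinv (block_DR D R) $ Inl i)"

definition diag_mat :: "('m \<Rightarrow> real) \<Rightarrow> real^'m^'m" where
  "diag_mat k = (\<chi> i j. if i = j then k i else 0)"

definition Uspace :: "real^'c^'m \<Rightarrow> real^'c^'q \<Rightarrow> (real^'m) set" where
  "Uspace D R = {D *v \<zeta> | \<zeta>. R *v \<zeta> = 0}"

definition Vspace :: "real^'c^'m \<Rightarrow> real^'c^'q \<Rightarrow> real^'m^'m \<Rightarrow> (real^'m) set" where
  "Vspace D R K = {matrix_inv K *v \<sigma> | \<sigma>. transpose D *v \<sigma> \<in> range (\<lambda>y. transpose R *v y)}"

text \<open>Orthogonal complement w.r.t. the inner product (x,y) \<mapsto> x^T K y.\<close>
definition K_orth_comp :: "real^'m^'m \<Rightarrow> (real^'m) set \<Rightarrow> (real^'m) set" where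
  "K_orth_comp K W = {x. \<forall>y\<in>W. x \<bullet> (K *v y) = 0}"

end

theory Submission
  imports Defs
begin

text \<open>Since \<open>Ker R = (Im R\<^sup>T)\<^sup>\<bottom>\<close>, a vector
\<open>\<sigma>\<close> is orthogonal to \<open>\<U> = D (Ker R)\<close> iff \<open>D\<^sup>T \<sigma> \<in> (Ker R)\<^sup>\<bottom> = Im R\<^sup>T\<close>; this is (i) and,
read at \<open>-\<sigma> + H f\<close>, also (ii), whatever \<open>H\<close> is. For the symmetric invertible \<open>K\<close> the
\<open>K\<close>-orthogonal complement of \<open>\<U>\<close> is \<open>K\<^sup>-\<^sup>1 \<U>\<^sup>\<bottom>\<close>. As \<open>D\<close> is injective on
\<open>Ker R\<close>, \<open>dim \<U> = dim Ker R = nd - rank R\<close>, and \<open>dim \<V> = dim \<U>\<^sup>\<bottom> = m - dim \<U>\<close>.\<close>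

lemma null_space_eq_orthogonal_comp_range_transpose:
  fixes A :: "real^'n^'m"
  shows "{x. A *v x = 0} = orthogonal_comp (range ((*v) (transpose A)))"
  using ker_orthogonal_comp_adjoint[OF matrix_vector_mul_linear, of A]
  by (simp add: adjoint_matrix vimage_def)

lemma subspace_null_space: "subspace {x. (A :: real^'n^'m) *v x = 0}"
  unfolding null_space_eq_orthogonal_comp_range_transpose by (rule subspace_orthogonal_comp)

lemma orthogonal_comp_image_matrix:
  fixes A :: "real^'n^'m"
  shows "orthogonal_comp ((*v) A ` S) = {y. transpose A *v y \<in> orthogonal_comp S}"
proof -
  have "(A *v x) \<bullet> y = x \<bullet> (transpose A *v y)" for x y
    by (metis dot_lmul_matrix inner_commute vector_transpose_matrix)
  then show ?thesis
    by (auto simp: orthogonal_comp_def orthogonal_def)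
qed

lemma orthogonal_comp_image_null_space:
  fixes A :: "real^'n^'m" and B :: "real^'n^'k"
  shows "orthogonal_comp ((*v) A ` {x. B *v x = 0}) =
    {y. transpose A *v y \<in> range ((*v) (transpose B))}"
proof -
  have "subspace (range ((*v) (transpose B)))"
    by (rule linear_subspace_image[OF matrix_vector_mul_linear subspace_UNIV])
  then have "orthogonal_comp {x. B *v x = 0} = range ((*v) (transpose B))"
    by (simp only: null_space_eq_orthogonal_comp_range_transpose orthogonal_comp_self)
  then show ?thesis
    by (simp only: orthogonal_comp_image_matrix)
qed

lemma dim_orthogonal_comp:
  fixes W :: "'a::euclidean_space set"
  assumes "subspace W"
  shows "dim (orthogonal_comp W) + dim W = DIM('a)"
  using dim_subspace_orthogonal_to_vectors[OF assms subspace_UNIV subset_UNIV]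
  by (simp add: orthogonal_comp_def)

lemma dim_null_space_add_rank:
  fixes A :: "real^'n^'m"
  shows "dim {x. A *v x = 0} + rank A = CARD('n)"
  using dim_orthogonal_comp[OF linear_subspace_image[OF matrix_vector_mul_linear subspace_UNIV],
      of "transpose A"]
  by (simp only: null_space_eq_orthogonal_comp_range_transpose rank_dim_range[symmetric]
      rank_transpose DIM_cart DIM_real mult_1_right)

lemma dim_image_matrix_eq:
  fixes A :: "real^'n^'m"
  assumes "subspace S" and "{x. A *v x = 0} \<inter> S = {0}"
  shows "dim ((*v) A ` S) = dim S"
proof (rule dim_image_eq[OF matrix_vector_mul_linear])
  show "inj_on ((*v) A) (span S)"
  proof (rule inj_onI)
    fix x y assume "x \<in> span S" "y \<in> span S" "A *v x = A *v y"
    then have "x - y \<in> {x. A *v x = 0} \<inter> S"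
      using \<open>subspace S\<close>
      by (simp add: span_eq_iff[THEN iffD2] subspace_diff matrix_vector_mult_diff_distrib)
    then show "x = y"
      using assms(2) by auto
  qed
qed

lemma matrix_mul_matrix_inv:
  fixes A :: "'a::semiring_1^'n^'m"
  assumes "invertible A"
  shows "A ** matrix_inv A = mat 1" and "matrix_inv A ** A = mat 1"
  using someI_ex[OF assms[unfolded invertible_def]] by (simp_all add: matrix_inv_def)

lemma invertible_matrix_inv:
  fixes A :: "'a::semiring_1^'n^'m"
  assumes "invertible A"
  shows "invertible (matrix_inv A)"
  using matrix_mul_matrix_inv[OF assms] invertible_def by blast

lemma invertible_diag_mat:
  assumes "\<And>i. k i \<noteq> 0"
  shows "invertible (diag_mat k)"
proof -
  have "diag_mat k ** diag_mat (\<lambda>i. inverse (k i)) = mat 1"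
    using assms by (simp add: diag_mat_def matrix_matrix_mult_def mat_def vec_eq_iff
        if_distrib[of "\<lambda>x. x * _"] sum.delta cong: if_cong)
  then show ?thesis
    using invertible_right_inverse by blast
qed

lemma transpose_diag_mat [simp]: "transpose (diag_mat k) = diag_mat k"
  by (simp add: diag_mat_def transpose_def vec_eq_iff)

lemma K_orth_comp_eq_preimage:
  assumes "transpose K = K"
  shows "K_orth_comp K W = {x. K *v x \<in> orthogonal_comp W}"
proof -
  have "x \<bullet> (K *v y) = y \<bullet> (K *v x)" for x y
    by (metis assms dot_lmul_matrix inner_commute vector_transpose_matrix)
  then show ?thesis
    by (simp add: K_orth_comp_def orthogonal_comp_def orthogonal_def)
qed

lemma K_orth_comp_eq_image_matrix_inv:
  assumes "transpose K = K" and "invertible K"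
  shows "K_orth_comp K W = (*v) (matrix_inv K) ` orthogonal_comp W"
proof -
  have "matrix_inv K *v (K *v x) = x" "K *v (matrix_inv K *v y) = y" for x y
    using matrix_mul_matrix_inv[OF assms(2)] by (simp_all add: matrix_vector_mul_assoc)
  then show ?thesis
    unfolding K_orth_comp_eq_preimage[OF assms(1)] by (auto intro!: image_eqI[where x="K *v _"])
qed

lemma dim_image_invertible:
  fixes A :: "real^'n^'n"
  assumes "invertible A"
  shows "dim ((*v) A ` S) = dim S"
  using inj_on_subset[OF inj_matrix_vector_mult[OF assms]]
  by (simp add: dim_image_eq[OF matrix_vector_mul_linear])

lemma Uspace_eq_image: "Uspace D R = (*v) D ` {\<zeta>. R *v \<zeta> = 0}"
  by (auto simp: Uspace_def)

lemma subspace_Uspace: "subspace (Uspace D R)"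
  unfolding Uspace_eq_image
  by (rule linear_subspace_image[OF matrix_vector_mul_linear subspace_null_space])

lemma orthogonal_comp_Uspace:
  "orthogonal_comp (Uspace D R) = {\<sigma>. transpose D *v \<sigma> \<in> range (\<lambda>y. transpose R *v y)}"
  unfolding Uspace_eq_image orthogonal_comp_image_null_space by simp

lemma Vspace_eq_image_orthogonal_comp_Uspace:
  "Vspace D R K = (*v) (matrix_inv K) ` orthogonal_comp (Uspace D R)"
  by (auto simp: Vspace_def orthogonal_comp_Uspace)

theorem proposition7:
  fixes Q :: "real^'m::finite^'n::finite"
    and \<xi>0 :: "real^('n \<times> 'd::finite)"
    and R :: "real^('n \<times> 'd)^'q::finite"
    and k :: "'m \<Rightarrow> real"
  defines "D \<equiv> Dphi Q \<xi>0"
    and "K \<equiv> diag_mat k"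
  assumes Q: "incidence_matrix Q"
    and distinct_ends: "\<And>i j j'. Q$j$i = 1 \<Longrightarrow> Q$j'$i = -1 \<Longrightarrow>
        (\<chi> c::'d. \<xi>0$(j,c)) \<noteq> (\<chi> c. \<xi>0$(j',c))"
    and k_pos: "\<And>i. k i > 0"
    and rankR: "rank R = CARD('q)"
    and ker: "{\<zeta>. D *v \<zeta> = 0} \<inter> {\<zeta>. R *v \<zeta> = 0} = {0}"
  shows
    "(orthogonal_comp (Uspace D R) =
        {\<sigma>. transpose D *v \<sigma> \<in> range (\<lambda>y. transpose R *v y)}
      \<and> Vspace D R K = (\<lambda>x. matrix_inv K *v x) ` orthogonal_comp (Uspace D R)
      \<and> dim (orthogonal_comp (Uspace D R)) = dim (Vspace D R K)
      \<and> Vspace D R K = K_orth_comp K (Uspace D R))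
     \<and> (\<forall>\<sigma> f. (transpose D *v (- \<sigma> + Hmat D R *v f) \<in> range (\<lambda>y. transpose R *v y))
                \<longleftrightarrow> (- \<sigma> + Hmat D R *v f \<in> orthogonal_comp (Uspace D R)))
     \<and> (dim (Uspace D R) = dim {\<zeta>. R *v \<zeta> = 0}
      \<and> dim {\<zeta>. R *v \<zeta> = 0} = CARD('n) * CARD('d) - CARD('q)
      \<and> int (dim (Vspace D R K)) = int CARD('m) - int (CARD('n) * CARD('d)) + int CARD('q))"
proof -
  let ?N = "{\<zeta>. R *v \<zeta> = 0}" and ?U = "Uspace D R"
  have K_sym: "transpose K = K" and K_inv: "invertible K"
    using k_pos by (simp_all add: K_def invertible_diag_mat less_imp_neq[symmetric])
  have U_perp: "orthogonal_comp ?U = {\<sigma>. transpose D *v \<sigma> \<in> range (\<lambda>y. transpose R *v y)}"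
    by (rule orthogonal_comp_Uspace)
  have V: "Vspace D R K = (\<lambda>x. matrix_inv K *v x) ` orthogonal_comp ?U"
    by (rule Vspace_eq_image_orthogonal_comp_Uspace)
  have dim_V: "dim (orthogonal_comp ?U) = dim (Vspace D R K)"
    unfolding V using dim_image_invertible[OF invertible_matrix_inv[OF K_inv]] by simp
  have dim_U: "dim ?U = dim ?N"
    unfolding Uspace_eq_image using ker by (simp add: dim_image_matrix_eq subspace_null_space)
  have dim_N: "dim ?N + CARD('q) = CARD('n) * CARD('d)"
    using dim_null_space_add_rank[of R] rankR by simp
  have dim_U_perp: "dim (orthogonal_comp ?U) + dim ?U = CARD('m)"
    using dim_orthogonal_comp[OF subspace_Uspace] by simp
  then have dim_V_count:
    "int (dim (Vspace D R K)) = int CARD('m) - int (CARD('n) * CARD('d)) + int CARD('q)"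
    using dim_V dim_U dim_N by linarith
  moreover have "dim ?N = CARD('n) * CARD('d) - CARD('q)"
    using dim_N by simp
  ultimately show ?thesis
    using U_perp V dim_V K_orth_comp_eq_image_matrix_inv[OF K_sym K_inv, of ?U] dim_U
    by (simp only: mem_Collect_eq simp_thms)
qed

end
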